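(* Let $p$ be a prime number and let $R$ be a non-nilpotent, commutative small profinite ring of characteristic $p$ which is nil of nilexponent $p$. Assume additionally that the quotient ring $R/\mathrm{Ann}(a)$ is non-nilpotent for every $a\in R\setminus\{0\}$. Then for every polynomial $f(x_1,\dots,x_n)\in \mathbb{F}_p[x_1,\dots,x_n]\setminus\{0\}$ with $\deg_{x_1}(f),\dots,\deg_{x_n}(f)<p$ and for all independent tuples $(g_1,\dots,g_n)$ of generics of $R$ we have $f(g_1,\dots,g_n)\neq 0$.
   Context: Rings are associative and not necessarily unital. A small profinite ring is a pair $(R,\mathrm{Aut}^*(R))$, where $R$ is the inverse limit of a distinguished countable inverse system of finite rings (equivalently, a compact topological ring with a distinguished countable basis of open neighbourhoods of $0$ consisting of clopen ideals), $\mathrm{Aut}^*(R)$ is a closed subgroup of the group of all automorphisms of $R$ respecting the inverse system (equivalently, fixing setwise the clopen ideals of the distinguished basis), and for every $n<\omega$ the group $\mathrm{Aut}^*(R)$ has only countably many orbits on $R^{\times n}$. For $A\subseteq R$, $\mathrm{Aut}^*(R/A)$ is the pointwise stabilizer of $A$ in $\mathrm{Aut}^*(R)$, and for a finite tuple $a$ of elements of $R$, $o(a/A)=\{h(a):h\in\mathrm{Aut}^*(R/A)\}$. An element $g\in R$ is generic (over $\emptyset$) if $o(g/\emptyset)$ is open in $R$. For finite tuples $a,b$ and finite $A\subseteq R$, $a$ is $m$-independent from $b$ over $A$ if the orbit $o(a/Ab)$ is open in $o(a/A)$. A tuple $(g_1,\dots,g_n)$ of generics is independent if for each $i$, $g_i$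 is $m$-independent from $(g_1,\dots,g_{i-1})$ over $\emptyset$. $\mathrm{Ann}(a)=\{r\in R: ra=ar=0\}$. A ring is nilpotent if for some $k\geq 1$ all products of $k$ elements are $0$. A ring is nil of nilexponent $p$ if $r^p=0$ for all $r$ and $p$ is the least number with this property. Since $R$ has no unit, if $f$ has a non-zero constant term, $f(g_1,\dots,g_n)$ is evaluated in the unitization $\mathbb{F}_p\oplus R$. *)

theory Defs
  imports
    "HOL-Analysis.Analysis"
    "HOL-Library.Poly_Mapping"
    "Berlekamp_Zassenhaus.Finite_Field"
begin

section \<open>Rings without unit\<close>

text \<open>Rings are types of class \<^class>\<open>ring\<close>, which has no unit; hence neither
  \<^const>\<open>power\<close> nor \<^const>\<open>of_nat\<close> is available.\<close>

definition nmul :: "nat \<Rightarrow> 'a::comm_monoid_add \<Rightarrow> 'a" where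
  "nmul k r = (\<Sum>i<k. r)"

text \<open>The product of a nonempty list. The operation is a parameter so that the definition
  also serves for the quotient rings below.\<close>

definition list_product :: "('b \<Rightarrow> 'b \<Rightarrow> 'b) \<Rightarrow> 'b list \<Rightarrow> 'b" where
  "list_product mul xs = foldl mul (hd xs) (tl xs)"

definition pos_power :: "'a::semigroup_mult \<Rightarrow> nat \<Rightarrow> 'a" where
  "pos_power r k = list_product (*) (replicate k r)"

definition nilpotent_structure :: "'b set \<Rightarrow> ('b \<Rightarrow> 'b \<Rightarrow> 'b) \<Rightarrow> 'b \<Rightarrow> bool" where
  "nilpotent_structure C mul z \<longleftrightarrow>
     (\<exists>k\<ge>1. \<forall>xs. length xs = k \<and> set xs \<subseteq> C \<longrightarrow> list_product mul xs = z)"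

definition nilpotent_ring :: "'a::ring itself \<Rightarrow> bool" where
  "nilpotent_ring _ \<longleftrightarrow> nilpotent_structure (UNIV :: 'a set) (*) 0"

definition has_char :: "'a::ring itself \<Rightarrow> nat \<Rightarrow> bool" where
  "has_char _ p \<longleftrightarrow> p \<ge> 1 \<and> (\<forall>r::'a. nmul p r = 0)
     \<and> (\<forall>m. 1 \<le> m \<and> m < p \<longrightarrow> \<not> (\<forall>r::'a. nmul m r = 0))"

definition nil_of_nilexponent :: "'a::ring itself \<Rightarrow> nat \<Rightarrow> bool" where
  "nil_of_nilexponent _ p \<longleftrightarrow> p \<ge> 1 \<and> (\<forall>r::'a. pos_power r p = 0)
     \<and> (\<forall>m. 1 \<le> m \<and> m < p \<longrightarrow> \<not> (\<forall>r::'a. pos_power r m = 0))"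

definition two_sided_ideal :: "'a::ring set \<Rightarrow> bool" where
  "two_sided_ideal I \<longleftrightarrow> 0 \<in> I \<and> (\<forall>x\<in>I. \<forall>y\<in>I. x - y \<in> I)
     \<and> (\<forall>x\<in>I. \<forall>r. r * x \<in> I \<and> x * r \<in> I)"

definition Ann :: "'a::ring \<Rightarrow> 'a set" where
  "Ann a = {r. r * a = 0 \<and> a * r = 0}"

definition quot_carrier :: "'a::ring set \<Rightarrow> 'a set set" where
  "quot_carrier I = range (\<lambda>r. (+) r ` I)"

definition quot_mult :: "'a::ring set \<Rightarrow> 'a set \<Rightarrow> 'a set \<Rightarrow> 'a set" where
  "quot_mult I X Y = (\<Union>x\<in>X. \<Union>y\<in>Y. (+) (x * y) ` I)"

text \<open>The zero of the quotient ring is the coset \<open>I\<close>.\<close>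

definition nilpotent_quotient :: "'a::ring set \<Rightarrow> bool" where
  "nilpotent_quotient I \<longleftrightarrow> nilpotent_structure (quot_carrier I) (quot_mult I) I"


section \<open>Small profinite rings\<close>

text \<open>The ring automorphisms respecting the distinguished basis \<open>B\<close> of clopen ideals. They are
  homeomorphisms, because they fix setwise every member of a basis at \<open>0\<close>.\<close>

definition Aut_basis :: "'a::ring set set \<Rightarrow> ('a \<Rightarrow> 'a) set" where
  "Aut_basis B = {h. bij h \<and> (\<forall>x y. h (x + y) = h x + h y) \<and> (\<forall>x y. h (x * y) = h x * h y)
     \<and> (\<forall>I\<in>B. h ` I = I)}"

definition stab :: "('a \<Rightarrow> 'a) set \<Rightarrow> 'a set \<Rightarrow> ('a \<Rightarrow> 'a) set" where
  "stab G A = {h \<in> G. \<forall>a\<in>A. h a = a}"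

definition orb :: "('a \<Rightarrow> 'a) set \<Rightarrow> 'a set \<Rightarrow> 'a \<Rightarrow> 'a set" where
  "orb G A a = (\<lambda>h. h a) ` stab G A"

definition tuple_orb :: "('a \<Rightarrow> 'a) set \<Rightarrow> 'a set \<Rightarrow> 'a list \<Rightarrow> 'a list set" where
  "tuple_orb G A as = (\<lambda>h. map h as) ` stab G A"

locale profinite_ring =
  fixes B :: "'a::{ring, topological_ab_group_add, topological_semigroup_mult, t2_space} set set"
  assumes compact_ring: "compact (UNIV :: 'a set)"
    and countable_basis: "countable B"
    and basis_ideal: "\<And>I. I \<in> B \<Longrightarrow> two_sided_ideal I \<and> open I \<and> closed I"
    and basis_zero: "\<And>U. open U \<Longrightarrow> 0 \<in> U \<Longrightarrow> \<exists>I\<in>B. I \<subseteq> U"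

text \<open>Closedness of the group \<open>G\<close> refers to the topology of pointwise convergence. On
  \<open>Aut_basis B\<close> this is the usual profinite topology: an automorphism in \<open>Aut_basis B\<close> is
  determined modulo \<open>I \<in> B\<close> by its values at representatives of the finitely many cosets of \<open>I\<close>.\<close>

locale small_profinite_ring = profinite_ring B
  for B :: "'a::{ring, topological_ab_group_add, topological_semigroup_mult, t2_space} set set" +
  fixes G :: "('a \<Rightarrow> 'a) set"
  assumes group_sub: "G \<subseteq> Aut_basis B"
    and group_id: "id \<in> G"
    and group_comp: "\<And>g h. g \<in> G \<Longrightarrow> h \<in> G \<Longrightarrow> g \<circ> h \<in> G"
    and group_inv: "\<And>g. g \<in> G \<Longrightarrow> inv_into UNIV g \<in> G"
    and group_closed: "closedin (top_of_set (Aut_basis B)) G"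
    and small: "\<And>n. countable {tuple_orb G {} as |as. length as = n}"

definition generic :: "('a::topological_space \<Rightarrow> 'a) set \<Rightarrow> 'a \<Rightarrow> bool" where
  "generic G g \<longleftrightarrow> open (orb G {} g)"

text \<open>The independence of the element \<open>a\<close> (a tuple of length one) from the tuple \<open>bs\<close> over \<open>A\<close>.\<close>

definition m_independent ::
    "('a::topological_space \<Rightarrow> 'a) set \<Rightarrow> 'a \<Rightarrow> 'a list \<Rightarrow> 'a set \<Rightarrow> bool" where
  "m_independent G a bs A \<longleftrightarrow> openin (top_of_set (orb G A a)) (orb G (A \<union> set bs) a)"

definition independent_generics :: "('a::topological_space \<Rightarrow> 'a) set \<Rightarrow> 'a list \<Rightarrow> bool" where
  "independent_generics G gs \<longleftrightarrow>
     (\<forall>i<length gs. generic G (gs ! i) \<and> m_independent G (gs ! i) (take i gs) {})"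


section \<open>Polynomials and their values in the unitization\<close>

text \<open>A polynomial is a finitely supported map from monomials to coefficients. The variable
  \<open>x\<^sub>i\<^sub>+\<^sub>1\<close> has index \<open>i\<close>.\<close>

type_synonym 'c mpoly = "(nat \<Rightarrow>\<^sub>0 nat) \<Rightarrow>\<^sub>0 'c"

definition in_variables :: "nat \<Rightarrow> 'c::zero mpoly \<Rightarrow> bool" where
  "in_variables n f \<longleftrightarrow> (\<forall>m\<in>Poly_Mapping.keys f. Poly_Mapping.keys m \<subseteq> {..<n})"

definition degree_in :: "nat \<Rightarrow> 'c::zero mpoly \<Rightarrow> nat" where
  "degree_in i f = Max (insert 0 ((\<lambda>m. Poly_Mapping.lookup m i) ` Poly_Mapping.keys f))"

text \<open>The unitization is the product of the prime field with the ring, with the componentwise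
  addition of the product type. Scalars act through their representatives in
  \<open>{0..<p}\<close>; this makes the product a ring when the second factor has characteristic
  \<open>p = CARD('p)\<close>.\<close>

definition scal :: "'p::prime_card mod_ring \<Rightarrow> 'a::ring \<Rightarrow> 'a" where
  "scal c r = nmul (nat (to_int_mod_ring c)) r"

definition unit_mult ::
    "'p::prime_card mod_ring \<times> 'a::ring \<Rightarrow> 'p mod_ring \<times> 'a \<Rightarrow> 'p mod_ring \<times> 'a" where
  "unit_mult u v =
     (fst u * fst v, scal (fst u) (snd v) + scal (fst v) (snd u) + snd u * snd v)"

definition unit_one :: "'p::prime_card mod_ring \<times> 'a::ring" where
  "unit_one = (1, 0)"

definition unit_power :: "'p::prime_card mod_ring \<times> 'a::ring \<Rightarrow> nat \<Rightarrow> 'p mod_ring \<times> 'a" where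
  "unit_power u k = (unit_mult u ^^ k) unit_one"

definition monomial_value :: "'a::ring list \<Rightarrow> (nat \<Rightarrow>\<^sub>0 nat) \<Rightarrow> 'p::prime_card mod_ring \<times> 'a" where
  "monomial_value gs m =
     foldr unit_mult (map (\<lambda>i. unit_power (0, gs ! i) (Poly_Mapping.lookup m i)) [0..<length gs]) unit_one"

definition poly_value :: "'a::ring list \<Rightarrow> 'p::prime_card mod_ring mpoly \<Rightarrow> 'p mod_ring \<times> 'a" where
  "poly_value gs f = (\<Sum>m\<in>Poly_Mapping.keys f. unit_mult (Poly_Mapping.lookup f m, 0) (monomial_value gs m))"

end

theory Submission
  imports Defs "HOL-Computational_Algebra.Polynomial" "HOL-Number_Theory.Cong"
begin

text \<open>If \<open>f(g\<^sub>1, \<dots>, g\<^sub>n) = 0\<close>, then by independence and genericity the automorphisms fixing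
  \<open>g\<^sub>1, \<dots>, g\<^sub>n\<^sub>-\<^sub>1\<close> move \<open>g\<^sub>n\<close> to \<open>g\<^sub>n + x\<close> for every \<open>x\<close> in some clopen ideal \<open>I\<close>, so
  \<open>f(g\<^sub>1, \<dots>, g\<^sub>n\<^sub>-\<^sub>1, g\<^sub>n + k x) = 0\<close> for all \<open>x \<in> I\<close> and all \<open>p\<close> scalars \<open>k\<close>. Since the degree
  \<open>d\<close> in the last variable is below \<open>p\<close>, the leading coefficient \<open>u\<close>, nonzero by induction on
  \<open>n\<close>, satisfies \<open>u x\<^sup>d = 0\<close> on \<open>I\<close>; polarizing, \<open>u I\<^sup>d = 0\<close>. The finite nil ring \<open>R/I\<close> is
  nilpotent, so \<open>u\<close> kills all sufficiently long products of elements of \<open>R\<close>. If \<open>u \<in> R\<close>, then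
  \<open>R/Ann(u)\<close> is nilpotent; otherwise \<open>u\<close> is invertible in the unitization and \<open>R\<close> itself is
  nilpotent.\<close>

hide_const (open) UnivPoly.coeff Module.smult

section \<open>Polynomials vanishing modulo a prime\<close>

text \<open>Multiply by an inverse of \<open>k\<close> modulo \<open>m\<close>. Cancellation rests
  on coprimality alone, so zero divisors in the ring do no harm.\<close>

lemma dvd_of_int_mult_cancel:
  fixes x :: "'a::comm_ring_1"
  assumes "coprime k m" and "of_int m dvd of_int k * x"
  shows "of_int m dvd x"
proof -
  obtain u where "[k * u = 1] (mod m)"
    using cong_solve_coprime_int[OF assms(1)] by blast
  then obtain v where v: "k * u = 1 + m * v"
    by (metis cong_iff_lin cong_sym)
  have "of_int (k * u) * x = x + of_int m * (of_int v * x)"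
    by (simp add: v algebra_simps)
  then have "x = of_int u * (of_int k * x) - of_int m * (of_int v * x)"
    by (simp add: algebra_simps)
  then show ?thesis
    using assms(2) by (metis dvd_diff dvd_mult dvd_triv_left)
qed

lemma coprime_less_prime_int:
  fixes k l p :: nat
  assumes "prime p" "k < p" "l < p" "k \<noteq> l"
  shows "coprime (int k - int l) (int p)"
proof -
  have "\<not> int p dvd int k - int l"
    using assms zdvd_not_zless[of "\<bar>int k - int l\<bar>" "int p"] by auto
  then show ?thesis
    using assms(1) by (simp add: coprime_commute prime_imp_coprime)
qed

lemma dvd_coeff_if_dvd_values:
  fixes q :: "'a::comm_ring_1 poly"
  assumes p: "prime p" and "n < p" and "degree q \<le> n"
    and "\<And>k. k \<le> n \<Longrightarrow> of_nat p dvd poly q (of_nat k)"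
  shows "of_nat p dvd coeff q i"
  using assms(2-)
proof (induction n arbitrary: q i)
  case 0
  then obtain c where "q = [:c:]"
    by (metis degree_eq_zeroE le_zero_eq)
  then show ?case
    using "0.prems"(3)[of 0] by (cases i) auto
next
  case (Suc n)
  define s where "s = synthetic_div q (of_nat (Suc n))"
  define c where "c = poly q (of_nat (Suc n))"
  have q: "q = [:- of_nat (Suc n), 1:] * s + [:c:]"
    unfolding s_def c_def by (rule synthetic_div_correct'[symmetric])
  have c: "of_nat p dvd c"
    unfolding c_def using Suc.prems(3) by blast
  have s: "of_nat p dvd coeff s j" for j
  proof (rule Suc.IH)
    show "n < p" "degree s \<le> n"
      using Suc.prems unfolding s_def by (auto simp: degree_synthetic_div)
    fix k assume k: "k \<le> n"
    have "of_nat p dvd poly q (of_nat k)"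
      using Suc.prems(3) k by simp
    moreover have "poly q (of_nat k) = of_int (int k - int (Suc n)) * poly s (of_nat k) + c"
      by (subst q) (simp add: algebra_simps)
    ultimately have "of_int (int p) dvd of_int (int k - int (Suc n)) * poly s (of_nat k)"
      using c by (simp add: dvd_add_left_iff)
    then show "of_nat p dvd poly s (of_nat k)"
      using dvd_of_int_mult_cancel[OF coprime_less_prime_int[OF p, of k "Suc n"]] Suc.prems(1) k
      by simp
  qed
  have "coeff q i = coeff (pCons 0 s) i - of_nat (Suc n) * coeff s i + coeff [:c:] i"
    by (subst q) (simp add: algebra_simps)
  moreover have "of_nat p dvd coeff (pCons 0 s) i" "of_nat p dvd coeff [:c:] i"
    using s c by (cases i; simp add: coeff_pCons)+
  ultimately show ?case
    using s[of i] by (simp del: of_nat_Suc)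
qed

lemma degree_linear_power_le: "degree ([:a, b:] ^ n) \<le> n" for a b :: "'a::comm_ring_1"
  by (rule order_trans[OF degree_power_le]) simp

text \<open>Along the line \<open>g + k x\<close> the sum is a polynomial in \<open>k\<close> of
  degree at most \<open>d\<close>, and only the summand \<open>j = d\<close> contributes to the
  coefficient of \<open>k^d\<close>.\<close>

lemma dvd_leading_term_if_dvd_line:
  fixes g x :: "'a::comm_ring_1"
  assumes p: "prime p" "d < p"
    and line: "\<And>k. of_nat p dvd (\<Sum>j\<le>d. c j * (g + of_nat k * x) ^ j)"
  shows "of_nat p dvd c d * x ^ d"
proof -
  define q where "q = (\<Sum>j\<le>d. smult (c j) ([:g, x:] ^ j))"
  have "degree q \<le> d"
    unfolding q_def
    by (intro degree_sum_le)
      (auto intro: order_trans[OF degree_smult_le] order_trans[OF degree_linear_power_le])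
  moreover have "of_nat p dvd poly q (of_nat k)" for k
    using line[of k] by (simp add: q_def poly_sum)
  ultimately have "of_nat p dvd coeff q d"
    using dvd_coeff_if_dvd_values[OF p] by blast
  also have "coeff q d = (\<Sum>j\<le>d. if j = d then c d * x ^ d else 0)"
    unfolding q_def coeff_sum
  proof (intro sum.cong refl)
    fix j assume "j \<in> {..d}"
    then show "coeff (smult (c j) ([:g, x:] ^ j)) d = (if j = d then c d * x ^ d else 0)"
      using le_less_trans[OF degree_linear_power_le, of j d g x]
      by (auto simp: coeff_linear_poly_power coeff_eq_0)
  qed
  finally show ?thesis by simp
qed

text \<open>Factors of the power are exchanged one at a time for entries of \<open>xs\<close>. Each
  exchange costs the current degree as an integer factor, which is invertible modulo
  \<open>p\<close>.\<close>

lemma dvd_polarize: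
  fixes a :: "'a::comm_ring_1"
  assumes p: "prime p" and "d < p"
    and "J \<noteq> {}" and add: "\<And>x y. x \<in> J \<Longrightarrow> y \<in> J \<Longrightarrow> x + y \<in> J"
    and "\<And>x. x \<in> J \<Longrightarrow> of_nat p dvd a * x ^ d"
    and "length xs = d" "set xs \<subseteq> J"
  shows "of_nat p dvd a * prod_list xs"
  using assms(2,5-)
proof (induction d arbitrary: a xs)
  case 0
  \<comment> \<open>Any single element of \<open>J\<close> already shows that \<open>p\<close>
    divides \<open>a\<close>.\<close>
  then show ?case
    using \<open>J \<noteq> {}\<close> by auto
next
  case (Suc d)
  then obtain y ys where xs: "xs = y # ys" "y \<in> J" "length ys = d" "set ys \<subseteq> J"
    by (cases xs) auto
  have "of_nat p dvd (a * y) * x ^ d" if x: "x \<in> J" for x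
  proof -
    \<comment> \<open>In the expansion of \<open>a (y + k x)^(d + 1)\<close> the coefficient of
      \<open>k^d\<close> is \<open>(d + 1) a y x^d\<close>.\<close>
    define q where "q = smult a ([:y, x:] ^ Suc d)"
    have "degree q \<le> Suc d"
      unfolding q_def by (rule order_trans[OF degree_smult_le degree_linear_power_le])
    moreover have "y + of_nat k * x \<in> J" for k
      using add x xs(2) by (induction k) (auto simp: algebra_simps)
    then have "of_nat p dvd poly q (of_nat k)" for k
      using Suc.prems(2) by (simp add: q_def del: power_Suc)
    ultimately have "of_nat p dvd coeff q d"
      using dvd_coeff_if_dvd_values[OF p Suc.prems(1)] by blast
    also have "coeff q d = of_int (int (Suc d) - int 0) * ((a * y) * x ^ d)"
      unfolding q_def by (simp add: coeff_linear_poly_power algebra_simps del: power_Suc)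
    finally have "of_int (int p) dvd of_int (int (Suc d) - int 0) * ((a * y) * x ^ d)"
      by simp
    then show ?thesis
      using dvd_of_int_mult_cancel[OF coprime_less_prime_int[OF p, of "Suc d" 0]] Suc.prems(1)
      by simp
  qed
  then have "of_nat p dvd (a * y) * prod_list ys"
    using Suc.IH[of "a * y" ys] Suc.prems(1) xs by simp
  then show ?case
    by (simp add: xs(1) mult.assoc)
qed

section \<open>The unitization over the integers\<close>

lemma nmul_0 [simp]: "nmul 0 r = 0"
  by (simp add: nmul_def)

lemma nmul_Suc [simp]: "nmul (Suc k) r = nmul k r + r"
  by (simp add: nmul_def)

lemma nmul_add: "nmul (m + n) r = nmul m r + nmul n r"
  by (induction n) (simp_all add: ac_simps)

lemma nmul_add_right: "nmul n (r + s) = nmul n r + nmul n s"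
  by (induction n) (simp_all add: ac_simps)

lemma nmul_mult_left: "nmul n r * s = nmul n (r * s)" for r :: "'a::ring"
  by (induction n) (simp_all add: algebra_simps)

lemma nmul_zero_right [simp]: "nmul n 0 = 0"
  by (induction n) simp_all

text \<open>Stands in for multiplication by \<open>of_int\<close>, which needs a unit. One of the
  two terms always vanishes, because \<open>nat\<close> sends negative integers to
  \<open>0\<close>.\<close>

definition zmul :: "int \<Rightarrow> 'a::ab_group_add \<Rightarrow> 'a" where
  "zmul k r = nmul (nat k) r - nmul (nat (- k)) r"

text \<open>Lets scalar identities be checked on arbitrary differences of naturals, without
  distinguishing signs.\<close>

lemma zmul_diff_int: "zmul (int m - int n) r = nmul m r - nmul n r"
proof (cases "n \<le> m")
  case True
  then have "m = (m - n) + n" by simp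
  then have "nmul m r = nmul (m - n) r + nmul n r"
    by (metis nmul_add)
  then show ?thesis
    using True by (simp add: zmul_def nat_diff_distrib)
next
  case False
  then have "n = (n - m) + m" by simp
  then have "nmul n r = nmul (n - m) r + nmul m r"
    by (metis nmul_add)
  then show ?thesis
    using False by (simp add: zmul_def nat_diff_distrib)
qed

lemma zmul_int: "zmul (int n) r = nmul n r"
  using zmul_diff_int[of n 0] by simp

lemma zmul_0 [simp]: "zmul 0 r = 0"
  by (simp add: zmul_def)

lemma zmul_1 [simp]: "zmul 1 r = r"
  by (simp add: zmul_def)

lemma zmul_zero_right [simp]: "zmul k 0 = 0"
  by (simp add: zmul_def)

lemma zmul_add: "zmul (k + l) r = zmul k r + zmul l r"
proof -
  obtain a b c d where "k = int a - int b" "l = int c - int d"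
    by (meson int_diff_cases)
  moreover have "int a - int b + (int c - int d) = int (a + c) - int (b + d)"
    by simp
  ultimately show ?thesis
    by (simp only: zmul_diff_int) (simp add: nmul_add)
qed

lemma zmul_add_right: "zmul k (r + s) = zmul k r + zmul k s"
  by (simp add: zmul_def nmul_add_right)

lemma zmul_minus: "zmul (- k) r = - zmul k r"
  using zmul_add[of k "- k" r] by (simp add: eq_neg_iff_add_eq_0 add.commute)

lemma zmul_mult: "zmul (k * l) r = zmul k (zmul l r)"
proof -
  have "zmul (int n * l) r = zmul (int n) (zmul l r)" for n
    by (induction n) (simp_all add: zmul_add algebra_simps)
  then show ?thesis
    by (cases k rule: int_cases2) (simp_all add: zmul_minus)
qed

lemma zmul_mult_left: "zmul k r * s = zmul k (r * s)" for r :: "'a::ring"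
  by (simp add: zmul_def nmul_mult_left algebra_simps)

lemma zmul_mult_right: "r * zmul k s = zmul k (r * s)" for r :: "'a::comm_ring"
  by (metis mult.commute zmul_mult_left)

lemma zmul_commute: "zmul k (zmul l r) = zmul l (zmul k r)"
  by (metis mult.commute zmul_mult)

text \<open>Scalars are integers rather than residues modulo the characteristic because only then
  is the unitization of every commutative ring, regardless of its characteristic, an instance of
  \<^class>\<open>comm_ring_1\<close>. The unitization over the field with \<open>p\<close> elements is its quotient by the
  multiples of \<open>p\<close>.\<close>

datatype 'a unitization = Unitization (scalar_part: int) (ring_part: 'a)

instantiation unitization :: (comm_ring) comm_ring_1
begin

definition zero_unitization :: "'a unitization" where
  "0 = Unitization 0 0"

definition one_unitization :: "'a unitization" where
  "1 = Unitization 1 0"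

definition plus_unitization :: "'a unitization \<Rightarrow> 'a unitization \<Rightarrow> 'a unitization" where
  "u + v = Unitization (scalar_part u + scalar_part v) (ring_part u + ring_part v)"

definition minus_unitization :: "'a unitization \<Rightarrow> 'a unitization \<Rightarrow> 'a unitization" where
  "u - v = Unitization (scalar_part u - scalar_part v) (ring_part u - ring_part v)"

definition uminus_unitization :: "'a unitization \<Rightarrow> 'a unitization" where
  "- u = Unitization (- scalar_part u) (- ring_part u)"

definition times_unitization :: "'a unitization \<Rightarrow> 'a unitization \<Rightarrow> 'a unitization" where
  "u * v = Unitization (scalar_part u * scalar_part v)
    (zmul (scalar_part u) (ring_part v) + zmul (scalar_part v) (ring_part u)
      + ring_part u * ring_part v)"

instance
  by standard
    (auto simp: zero_unitization_def one_unitization_def plus_unitization_def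
      minus_unitization_def uminus_unitization_def times_unitization_def algebra_simps
      zmul_add zmul_add_right zmul_mult zmul_mult_left zmul_mult_right zmul_commute)

end

lemma unitization_parts [simp]:
  "scalar_part 0 = 0" "ring_part 0 = 0"
  "scalar_part 1 = 1" "ring_part 1 = 0"
  "scalar_part (u + v) = scalar_part u + scalar_part v"
  "ring_part (u + v) = ring_part u + ring_part v"
  "scalar_part (u - v) = scalar_part u - scalar_part v"
  "ring_part (u - v) = ring_part u - ring_part v"
  "scalar_part (u * v) = scalar_part u * scalar_part v"
  "ring_part (u * v) = zmul (scalar_part u) (ring_part v) + zmul (scalar_part v) (ring_part u)
    + ring_part u * ring_part v"
  for u v :: "'a::comm_ring unitization"
  by (simp_all add: zero_unitization_def one_unitization_def plus_unitization_def
      minus_unitization_def times_unitization_def)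

lemma of_nat_unitization: "of_nat n = Unitization (int n) 0"
  by (induction n) (simp_all add: unitization.expand)

lemma of_int_unitization: "of_int k = Unitization k 0"
  by (cases k rule: int_diff_cases)
    (simp add: of_nat_unitization unitization.expand)

abbreviation embed :: "'a::comm_ring \<Rightarrow> 'a unitization" where
  "embed r \<equiv> Unitization 0 r"

lemma embed_add: "embed (r + s) = embed r + embed s"
  by (simp add: unitization.expand)

lemma embed_diff: "embed (r - s) = embed r - embed s"
  by (simp add: unitization.expand)

lemma embed_mult: "embed (r * s) = embed r * embed s"
  by (simp add: unitization.expand)

lemma mult_embed: "u * embed r = embed (zmul (scalar_part u) r + ring_part u * r)"
  by (simp add: unitization.expand)

text \<open>Moves products from the ring without unit to \<open>prod_list\<close>. The empty list is
  excluded: its \<open>prod_list\<close> is \<open>1\<close>, which is not in the image of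
  \<open>embed\<close>.\<close>

lemma embed_list_product:
  "xs \<noteq> [] \<Longrightarrow> embed (list_product (*) xs) = prod_list (map embed xs)"
proof (induction xs rule: rev_induct)
  case (snoc x xs)
  then show ?case
    by (cases xs) (auto simp: list_product_def embed_mult)
qed simp

lemma embed_pos_power:
  assumes "k \<ge> 1"
  shows "embed (pos_power r k) = embed r ^ k"
proof -
  have "replicate k r \<noteq> []" using assms by simp
  then show ?thesis
    unfolding pos_power_def by (simp add: embed_list_product prod_list_replicate)
qed

text \<open>Since \<open>p\<close> kills the ring, multiples of \<open>p\<close> have ring part
  \<open>0\<close>. Divisibility by \<open>p\<close> thus expresses vanishing in the unitization
  over the integers modulo \<open>p\<close>.\<close>

lemma dvd_unitization_iff:
  fixes u :: "'a::comm_ring unitization"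
  assumes "\<And>r::'a. nmul p r = 0"
  shows "of_nat p dvd u \<longleftrightarrow> int p dvd scalar_part u \<and> ring_part u = 0"
proof
  assume "of_nat p dvd u"
  then obtain v where "u = of_nat p * v" by (elim dvdE)
  then show "int p dvd scalar_part u \<and> ring_part u = 0"
    using assms by (simp add: of_nat_unitization zmul_int)
next
  assume "int p dvd scalar_part u \<and> ring_part u = 0"
  then obtain k where "scalar_part u = int p * k" "ring_part u = 0"
    by (auto elim: dvdE)
  then have "u = of_nat p * of_int k"
    by (simp add: of_nat_unitization of_int_unitization unitization.expand)
  then show "of_nat p dvd u" by simp
qed

section \<open>Nilpotency modulo an open ideal\<close>

text \<open>Pigeonhole: some element of \<open>S\<close> occurs at least \<open>p\<close> times in
  \<open>xs\<close>, and commutativity collects these occurrences into a \<open>p\<close>-th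
  power.\<close>

lemma prod_list_eq_0_if_nil:
  fixes xs :: "'a::comm_ring_1 list"
  assumes "finite S" "set xs \<subseteq> S" "card S * (p - 1) < length xs"
    and nil: "\<And>s. s \<in> S \<Longrightarrow> s ^ p = 0"
  shows "prod_list xs = 0"
proof -
  have "\<exists>s\<in>set xs. p \<le> count (mset xs) s"
  proof (rule ccontr)
    assume "\<not> ?thesis"
    then have "sum (count (mset xs)) (set xs) \<le> (\<Sum>s\<in>set xs. p - 1)"
      by (intro sum_mono) force
    also have "\<dots> \<le> card S * (p - 1)"
      using assms(1,2) by (simp add: card_mono)
    finally show False
      using assms(3) size_multiset_overloaded_eq[of "mset xs"] by simp
  qed
  then obtain s where s: "s \<in> set xs" "replicate_mset p s \<subseteq># mset xs"
    by (metis count_le_replicate_mset_subset_eq)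
  then obtain M where "mset xs = replicate_mset p s + M"
    by (metis subset_mset.add_diff_inverse)
  then have "prod_list xs = s ^ p * prod_mset M"
    by (metis prod_mset_prod_list prod_mset.union prod_mset_replicate_mset)
  then show ?thesis
    using nil s assms(2) by auto
qed

lemma two_sided_ideal_add:
  assumes "two_sided_ideal I" "x \<in> I" "y \<in> I"
  shows "x + y \<in> I"
proof -
  have "0 - y \<in> I" using assms unfolding two_sided_ideal_def by blast
  then have "x - (0 - y) \<in> I" using assms unfolding two_sided_ideal_def by blast
  then show ?thesis by simp
qed

lemma two_sided_ideal_zmul:
  assumes "two_sided_ideal I" "x \<in> I"
  shows "zmul k x \<in> I"
proof -
  have "nmul n x \<in> I" for n
    using assms by (induction n) (auto simp: two_sided_ideal_def intro: two_sided_ideal_add)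
  then show ?thesis
    using assms(1) unfolding zmul_def two_sided_ideal_def by blast
qed

text \<open>Scalars act by repeated addition and subtraction, so an ideal of the ring remains an
  ideal of the unitization.\<close>

lemma mult_embed_ideal:
  fixes I :: "'a::comm_ring set"
  assumes "two_sided_ideal I" "x \<in> embed ` I"
  shows "u * x \<in> embed ` I"
  using assms by (auto simp: mult_embed two_sided_ideal_def
      intro!: imageI two_sided_ideal_add two_sided_ideal_zmul)

text \<open>Telescoping: exchanging one factor for its representative changes the product by an
  element of \<open>I\<close>.\<close>

lemma prod_list_cong_ideal:
  fixes I :: "'a::comm_ring set"
  assumes I: "two_sided_ideal I" and r: "\<And>x. x - r x \<in> I"
  shows "prod_list (map embed xs) - prod_list (map (embed \<circ> r) xs) \<in> embed ` I"
proof (induction xs)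
  case Nil
  then show ?case
    using I by (auto simp: two_sided_ideal_def zero_unitization_def)
next
  case (Cons x xs)
  let ?P = "prod_list (map embed xs)" and ?Q = "prod_list (map (embed \<circ> r) xs)"
  have "embed x * ?P - embed (r x) * ?Q = ?P * embed (x - r x) + embed (r x) * (?P - ?Q)"
    by (simp add: embed_diff algebra_simps)
  moreover have "?P * embed (x - r x) \<in> embed ` I"
    using mult_embed_ideal[OF I] r by blast
  moreover have "embed (r x) * (?P - ?Q) \<in> embed ` I"
    using mult_embed_ideal[OF I] Cons.IH by blast
  moreover have "u + v \<in> embed ` I" if "u \<in> embed ` I" "v \<in> embed ` I" for u v
    using that by (auto simp: embed_add[symmetric] intro!: imageI two_sided_ideal_add[OF I])
  ultimately have "embed x * ?P - embed (r x) * ?Q \<in> embed ` I"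
    by metis
  then show ?case
    by (simp add: o_def)
qed

text \<open>Compactness leaves finitely many cosets of \<open>I\<close>. Modulo \<open>I\<close>, a
  long product can be formed from coset representatives only, and such a product vanishes by
  pigeonhole.\<close>

lemma nil_imp_product_in_open_ideal:
  fixes I :: "'a::{comm_ring, topological_ab_group_add} set"
  assumes compact: "compact (UNIV :: 'a set)"
    and I: "two_sided_ideal I" "open I"
    and nil: "\<And>x :: 'a unitization. scalar_part x = 0 \<Longrightarrow> x ^ p = 0"
  obtains K where "K \<ge> 1"
    "\<And>xs. length xs = K \<Longrightarrow> prod_list (map embed xs) \<in> embed ` I"
proof -
  have open_coset: "open ((\<lambda>x. x - s) -` I)" for s
    by (intro open_vimage I continuous_intros)
  have "UNIV \<subseteq> (\<Union>s. (\<lambda>x. x - s) -` I)"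
  proof
    fix x :: 'a
    have "x \<in> (\<lambda>y. y - x) -` I"
      using I(1) by (simp add: two_sided_ideal_def)
    then show "x \<in> (\<Union>s. (\<lambda>x. x - s) -` I)" by blast
  qed
  then obtain S where S: "finite S" "UNIV \<subseteq> (\<Union>s\<in>S. (\<lambda>x. x - s) -` I)"
    using compactE_image[OF compact, of UNIV "\<lambda>s. (\<lambda>x. x - s) -` I"] open_coset by auto
  then have "\<forall>x. \<exists>s\<in>S. x - s \<in> I" by auto
  then obtain r where r: "\<And>x. r x \<in> S" "\<And>x. x - r x \<in> I" by metis
  show thesis
  proof
    \<comment> \<open>One factor more than the \<open>p - 1\<close> occurrences allowed to each
      representative.\<close>
    show "Suc (card (embed ` S) * (p - 1)) \<ge> 1" by simp
    fix xs :: "'a list"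
    assume "length xs = Suc (card (embed ` S) * (p - 1))"
    then have "prod_list (map (embed \<circ> r) xs) = 0"
      using S(1) r(1) nil by (intro prod_list_eq_0_if_nil[of "embed ` S" _ p]) auto
    then show "prod_list (map embed xs) \<in> embed ` I"
      using prod_list_cong_ideal[OF I(1) r(2), of xs] by simp
  qed
qed

text \<open>The cross terms lie in the ideal, so \<open>quot_mult\<close> of two cosets is exactly
  the coset of the product of their representatives.\<close>

lemma list_product_quot_mult:
  assumes I: "two_sided_ideal I" and "xs \<noteq> []"
  shows "list_product (quot_mult I) (map (\<lambda>x. (+) x ` I) xs) = (+) (list_product (*) xs) ` I"
proof -
  have quot_mult: "quot_mult I ((+) x ` I) ((+) y ` I) = (+) (x * y) ` I" for x y
  proof (intro equalityI subsetI)
    fix z assume "z \<in> quot_mult I ((+) x ` I) ((+) y ` I)"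
    then obtain i j k where ijk: "i \<in> I" "j \<in> I" "k \<in> I" "z = (x + i) * (y + j) + k"
      by (auto simp: quot_mult_def)
    then have "z = x * y + (x * j + (i * (y + j) + k))"
      by (simp add: algebra_simps)
    moreover have "x * j + (i * (y + j) + k) \<in> I"
      using I ijk by (intro two_sided_ideal_add[OF I]) (auto simp: two_sided_ideal_def)
    ultimately show "z \<in> (+) (x * y) ` I" by blast
  next
    fix z assume "z \<in> (+) (x * y) ` I"
    moreover have "a \<in> (+) a ` I" for a
      using I by (auto simp: two_sided_ideal_def intro: image_eqI[of _ _ 0])
    ultimately show "z \<in> quot_mult I ((+) x ` I) ((+) y ` I)"
      unfolding quot_mult_def by (intro UN_I[of x] UN_I[of y])
  qed
  from \<open>xs \<noteq> []\<close> show ?thesis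
  proof (induction xs rule: rev_induct)
    case (snoc x xs)
    then show ?case
      by (cases xs) (auto simp: list_product_def quot_mult)
  qed simp
qed

text \<open>Lists of cosets lift to lists of representatives, so nilpotency of the quotient can be
  tested on products in the ring.\<close>

lemma nilpotent_quotientI:
  assumes I: "two_sided_ideal I" and "k \<ge> 1"
    and prod: "\<And>xs. length xs = k \<Longrightarrow> list_product (*) xs \<in> I"
  shows "nilpotent_quotient I"
  unfolding nilpotent_quotient_def nilpotent_structure_def
proof (rule exI[of _ k], intro conjI allI impI \<open>k \<ge> 1\<close>)
  fix Xs assume Xs: "length Xs = k \<and> set Xs \<subseteq> quot_carrier I"
  then have "Xs \<in> lists (range (\<lambda>x. (+) x ` I))"
    by (auto simp: quot_carrier_def)
  then obtain xs where xs: "Xs = map (\<lambda>x. (+) x ` I) xs"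
    by (auto simp: lists_image)
  have "xs \<noteq> []"
    using Xs \<open>k \<ge> 1\<close> xs by auto
  moreover have "(+) y ` I = I" if "y \<in> I" for y
  proof (intro equalityI subsetI)
    fix z assume "z \<in> I"
    then have "z - y \<in> I" using I that by (auto simp: two_sided_ideal_def)
    then show "z \<in> (+) y ` I" by (rule image_eqI[rotated]) simp
  qed (use I that in \<open>auto intro: two_sided_ideal_add\<close>)
  ultimately show "list_product (quot_mult I) Xs = I"
    using list_product_quot_mult[OF I] prod Xs xs by simp
qed

lemma two_sided_ideal_Ann: "two_sided_ideal (Ann a)" for a :: "'a::comm_ring"
proof -
  have "x * (s * a) = 0" if "x * a = 0" for x s
    using that by (metis mult.left_commute mult_zero_right)
  then show ?thesis
    by (auto simp: two_sided_ideal_def Ann_def algebra_simps)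
qed

text \<open>Otherwise polarization makes \<open>u\<close> kill, modulo \<open>p\<close>, all
  products of \<open>d\<close> elements of \<open>I\<close>, hence all products of
  \<open>d * K\<close> ring elements. Whether \<open>p\<close> divides the scalar part of
  \<open>u\<close> decides which non-nilpotency assumption is contradicted.\<close>

lemma exists_not_dvd_mult_power:
  fixes I :: "'a::{comm_ring, topological_ab_group_add} set"
  assumes p: "prime p" "d < p"
    and compact: "compact (UNIV :: 'a set)"
    and I: "two_sided_ideal I" "open I"
    and char: "\<And>r::'a. nmul p r = 0"
    and nil: "\<And>u::'a unitization. scalar_part u = 0 \<Longrightarrow> u ^ p = 0"
    and non_nilpotent: "\<not> nilpotent_ring TYPE('a)"
    and quotients: "\<And>a::'a. a \<noteq> 0 \<Longrightarrow> \<not> nilpotent_quotient (Ann a)"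
    and u: "\<not> of_nat p dvd u"
  shows "\<exists>x\<in>I. \<not> of_nat p dvd u * embed x ^ d"
proof (rule ccontr)
  assume "\<not> ?thesis"
  then have powers: "of_nat p dvd u * embed x ^ d" if "x \<in> I" for x
    using that by blast
  have "0 \<in> I"
    using I(1) by (simp add: two_sided_ideal_def)
  \<comment> \<open>For \<open>d = 0\<close> the power is \<open>1\<close>, and the assumption would
    say that \<open>p\<close> divides \<open>u\<close>.\<close>
  have "d \<noteq> 0"
    using powers[OF \<open>0 \<in> I\<close>] u by (auto intro: ccontr)
  have polarized: "of_nat p dvd u * prod_list ys" if "length ys = d" "set ys \<subseteq> embed ` I" for ys
    using that powers \<open>0 \<in> I\<close> two_sided_ideal_add[OF I(1)]
    by (intro dvd_polarize[OF p, of "embed ` I"]) (auto simp: embed_add[symmetric])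
  obtain K where K: "K \<ge> 1"
    "\<And>xs. length xs = K \<Longrightarrow> prod_list (map embed xs) \<in> embed ` I"
    using nil_imp_product_in_open_ideal[OF compact I nil] by blast
  \<comment> \<open>Cut the list into \<open>m\<close> blocks of length \<open>K\<close>; the
    product of each block lies in \<open>I\<close>.\<close>
  have blocks: "\<exists>ys. length ys = m \<and> set ys \<subseteq> embed ` I \<and> prod_list ys = prod_list (map embed xs)"
    if "length xs = m * K" for m and xs :: "'a list"
    using that
  proof (induction m arbitrary: xs)
    case (Suc m)
    have "length (drop K xs) = m * K"
      using Suc.prems by simp
    from Suc.IH[OF this] obtain ys where "length ys = m" "set ys \<subseteq> embed ` I"
      "prod_list ys = prod_list (map embed (drop K xs))"
      by auto
    moreover have "prod_list (map embed (take K xs)) \<in> embed ` I"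
      using K(2)[of "take K xs"] Suc.prems by simp
    moreover have "prod_list (map embed xs)
        = prod_list (map embed (take K xs)) * prod_list (map embed (drop K xs))"
      by (metis append_take_drop_id map_append prod_list.append)
    ultimately show ?case
      by (intro exI[of _ "prod_list (map embed (take K xs)) # ys"]) auto
  qed auto
  have length_pos: "d * K \<ge> 1"
    using \<open>d \<noteq> 0\<close> K(1) by simp
  have annihilates: "of_nat p dvd u * embed (list_product (*) xs)" if "length xs = d * K" for xs :: "'a list"
  proof -
    have "xs \<noteq> []" using that length_pos by auto
    then show ?thesis
      using blocks[OF that] polarized by (metis embed_list_product)
  qed
  let ?k = "scalar_part u" and ?r = "ring_part u"
  show False
  proof (cases "int p dvd ?k")
    case True
    then have "?r \<noteq> 0"
      using u dvd_unitization_iff[OF char] by blast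
    moreover have "list_product (*) xs \<in> Ann ?r" if xs: "length xs = d * K" for xs :: "'a list"
    proof -
      \<comment> \<open>The scalar part acts as \<open>0\<close>, so \<open>u\<close> multiplies
        ring elements as \<open>?r\<close> does.\<close>
      obtain l where "?k = l * int p"
        using True by (metis dvdE mult.commute)
      then have "zmul ?k r = 0" for r :: 'a
        by (simp add: zmul_mult zmul_int char)
      then show ?thesis
        using annihilates[OF xs] dvd_unitization_iff[OF char]
        by (simp add: mult_embed Ann_def mult.commute)
    qed
    ultimately show False
      using quotients nilpotent_quotientI[OF two_sided_ideal_Ann length_pos] by blast
  next
    case False
    \<comment> \<open>As \<open>u\<close> is the integer \<open>?k\<close> plus a nilpotent element,
      factoring a difference of \<open>p\<close>-th powers shows that \<open>u\<close> divides
      \<open>?k ^ p\<close>. This is coprime to \<open>p\<close>, so \<open>u\<close> is invertible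
      modulo \<open>p\<close>.\<close>
    have "(of_int ?k :: 'a unitization) - (- embed ?r) = u"
      by (simp add: of_int_unitization unitization.expand)
    moreover have "(- embed ?r) ^ p = 0"
      by (rule nil) (simp add: uminus_unitization_def)
    ultimately have "of_int ?k ^ p = u * (\<Sum>i<p. (- embed ?r) ^ (p - Suc i) * of_int ?k ^ i)"
      using power_diff_sumr2[of "of_int ?k" p "- embed ?r"] by simp
    then have "u dvd of_int (?k ^ p)"
      by (metis dvd_triv_left of_int_power)
    have "list_product (*) xs = 0" if xs: "length xs = d * K" for xs :: "'a list"
    proof -
      have "of_int (int p) dvd of_int (?k ^ p) * embed (list_product (*) xs)"
        using annihilates[OF xs] mult_dvd_mono[OF \<open>u dvd of_int (?k ^ p)\<close> dvd_refl]
        by (metis dvd_trans of_int_of_nat_eq)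
      moreover have "coprime (?k ^ p) (int p)"
        using False p(1) by (metis coprime_commute coprime_power_left_iff prime_imp_coprime
            prime_nat_int_transfer)
      ultimately have "of_nat p dvd embed (list_product (*) xs)"
        by (metis dvd_of_int_mult_cancel of_int_of_nat_eq)
      then show ?thesis
        using dvd_unitization_iff[OF char] by simp
    qed
    then show False
      using non_nilpotent length_pos
      unfolding nilpotent_ring_def nilpotent_structure_def by blast
  qed
qed

section \<open>Values at independent generics\<close>

text \<open>The orbit of \<open>gs ! i\<close> over the earlier entries is open in an open orbit,
  hence open in the ring. Containing \<open>gs ! i\<close>, it contains a coset
  \<open>gs ! i + I\<close> of a basis ideal.\<close>

lemma independent_generics_translate:
  fixes B :: "'a::{comm_ring, topological_ab_group_add, topological_semigroup_mult, t2_space} set set"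
  assumes R: "small_profinite_ring B G" and gs: "independent_generics G gs" "i < length gs"
  obtains I where "I \<in> B"
    "\<And>x. x \<in> I \<Longrightarrow> \<exists>h\<in>G. h (gs ! i) = gs ! i + x \<and> (\<forall>j<i. h (gs ! j) = gs ! j)"
proof -
  interpret small_profinite_ring B G by (rule R)
  let ?O = "orb G (set (take i gs)) (gs ! i)"
  have "open (orb G {} (gs ! i))" "openin (top_of_set (orb G {} (gs ! i))) ?O"
    using gs by (auto simp: independent_generics_def generic_def m_independent_def)
  then have "open ?O"
    by (meson openin_open_eq)
  then have "open ((\<lambda>x. gs ! i + x) -` ?O)"
    by (intro open_vimage continuous_intros)
  moreover have "gs ! i + 0 \<in> ?O"
    using group_id by (auto simp: orb_def stab_def intro!: image_eqI[of _ _ id])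
  ultimately obtain I where I: "I \<in> B" "I \<subseteq> (\<lambda>x. gs ! i + x) -` ?O"
    using basis_zero[of "(\<lambda>x. gs ! i + x) -` ?O"] by auto
  show thesis
  proof (rule that[OF I(1)])
    fix x assume "x \<in> I"
    then have "gs ! i + x \<in> ?O" using I(2) by blast
    then obtain h where h: "h \<in> G" "\<forall>a\<in>set (take i gs). h a = a" "gs ! i + x = h (gs ! i)"
      by (auto simp: orb_def stab_def)
    have "gs ! j \<in> set (take i gs)" if "j < i" for j
      using that gs(2) by (auto simp: in_set_conv_nth intro!: exI[of _ j])
    then show "\<exists>h\<in>G. h (gs ! i) = gs ! i + x \<and> (\<forall>j<i. h (gs ! j) = gs ! j)"
      using h by (intro bexI[of _ h]) auto
  qed
qed

text \<open>The map function of the datatype leaves the scalar part alone. It respects products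
  because an additive map commutes with integer multiples.\<close>

lemma map_unitization_hom:
  fixes h :: "'a::comm_ring \<Rightarrow> 'a"
  assumes add: "\<And>x y. h (x + y) = h x + h y" and mult: "\<And>x y. h (x * y) = h x * h y"
  shows "map_unitization h (u + v) = map_unitization h u + map_unitization h v"
    and "map_unitization h (u * v) = map_unitization h u * map_unitization h v"
    and "map_unitization h (of_int k) = of_int k"
proof -
  interpret h: additive h by standard (rule add)
  have "h (nmul n x) = nmul n (h x)" for n x
    by (induction n) (simp_all add: add h.zero)
  then have zmul: "h (zmul k x) = zmul k (h x)" for k x
    by (simp add: zmul_def h.diff)
  show "map_unitization h (u + v) = map_unitization h u + map_unitization h v"
    by (simp add: unitization.expand unitization.map_sel add)
  show "map_unitization h (u * v) = map_unitization h u * map_unitization h v"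
    by (simp add: unitization.expand unitization.map_sel add mult zmul)
  show "map_unitization h (of_int k) = of_int k"
    by (simp add: of_int_unitization h.zero)
qed

text \<open>Induction on the number of variables. Monomials are abstract indices with exponents
  \<open>e\<close>, so that passing to the coefficient of a power of the last variable merely
  shrinks the index set \<open>M\<close>.\<close>

lemma monomial_sum_not_dvd:
  fixes e :: "'m \<Rightarrow> nat \<Rightarrow> nat" and c :: "'m \<Rightarrow> int" and gs :: "'a::comm_ring list"
  assumes char: "\<And>r::'a. nmul p r = 0"
    and G: "\<And>h. h \<in> G \<Longrightarrow> (\<forall>x y. h (x + y) = h x + h y) \<and> (\<forall>x y. h (x * y) = h x * h y)"
    and ideal: "\<And>I. I \<in> B \<Longrightarrow> two_sided_ideal I"
    and translate: "\<And>i. i < length gs \<Longrightarrow> \<exists>I\<in>B. \<forall>x\<in>I. \<exists>h\<in>G.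
        h (gs ! i) = gs ! i + x \<and> (\<forall>j<i. h (gs ! j) = gs ! j)"
    and not_dvd: "\<And>u d I. \<not> of_nat p dvd u \<Longrightarrow> d < p \<Longrightarrow> I \<in> B \<Longrightarrow>
        \<exists>x\<in>I. \<not> of_nat p dvd u * embed x ^ d"
    and p: "prime p"
    and "n \<le> length gs" and "finite M"
    and "\<And>m m'. m \<in> M \<Longrightarrow> m' \<in> M \<Longrightarrow> (\<And>i. i < n \<Longrightarrow> e m i = e m' i) \<Longrightarrow> m = m'"
    and "\<And>m i. m \<in> M \<Longrightarrow> i < n \<Longrightarrow> e m i < p"
    and "\<exists>m\<in>M. \<not> int p dvd c m"
  shows "\<not> of_nat p dvd (\<Sum>m\<in>M. of_int (c m) * (\<Prod>i<n. embed (gs ! i) ^ e m i))"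
  using assms(7-)
proof (induction n arbitrary: M)
  case 0
  then obtain m where "m \<in> M" "\<not> int p dvd c m" by blast
  \<comment> \<open>Without variables, any two indices have the same exponents.\<close>
  then have "M = {m}" using 0 by auto
  then show ?case
    using \<open>\<not> int p dvd c m\<close> dvd_unitization_iff[OF char] by (simp add: of_int_unitization)
next
  case (Suc n)
  let ?g = "gs ! n"
  \<comment> \<open>\<open>W\<close> is the sum as a function of the last variable \<open>y\<close>,
    and \<open>E j\<close> is its coefficient at \<open>y ^ j\<close>.\<close>
  define P :: "'m \<Rightarrow> 'a unitization" where "P m = (\<Prod>i<n. embed (gs ! i) ^ e m i)" for m
  define E where "E j = (\<Sum>m\<in>{m\<in>M. e m n = j}. of_int (c m) * P m)" for j
  define W where "W y = (\<Sum>m\<in>M. of_int (c m) * (P m * y ^ e m n))" for y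
  \<comment> \<open>Integer coefficients divisible by \<open>p\<close> count as zero, so
    \<open>d\<close> is the degree in the last variable modulo \<open>p\<close>.\<close>
  define J where "J = (\<lambda>m. e m n) ` {m\<in>M. \<not> int p dvd c m}"
  define d where "d = Max J"
  have J: "finite J" "J \<noteq> {}"
    using Suc.prems by (auto simp: J_def)
  then have "d \<in> J"
    unfolding d_def by (rule Max_in)
  then have "d < p"
    using Suc.prems(4) by (auto simp: J_def)
  \<comment> \<open>Indices sharing the last exponent are still separated by the first
    \<open>n\<close> exponents.\<close>
  have "\<not> of_nat p dvd E d"
    unfolding E_def P_def
  proof (rule Suc.IH)
    show "\<exists>m\<in>{m\<in>M. e m n = d}. \<not> int p dvd c m"
      using \<open>d \<in> J\<close> by (auto simp: J_def)
    show "m = m'" if "m \<in> {m\<in>M. e m n = d}" "m' \<in> {m\<in>M. e m n = d}"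
      "\<And>i. i < n \<Longrightarrow> e m i = e m' i" for m m'
      using that by (intro Suc.prems(3)) (auto simp: less_Suc_eq)
  qed (use Suc.prems in auto)
  have above: "of_nat p dvd E j" if "d < j" for j
    unfolding E_def
  proof (rule dvd_sum)
    fix m assume m: "m \<in> {m\<in>M. e m n = j}"
    then have "e m n \<notin> J"
      using that Max_ge[OF J(1), of "e m n"] by (auto simp: d_def)
    then have "int p dvd c m"
      using m by (auto simp: J_def)
    then have "(of_int (int p) :: 'a unitization) dvd of_int (c m)"
      by (auto elim: dvdE)
    then show "of_nat p dvd of_int (c m) * P m" by simp
  qed
  have W: "W y = (\<Sum>j<p. E j * y ^ j)" for y
  proof -
    have "W y = (\<Sum>j<p. \<Sum>m\<in>{m\<in>M. e m n = j}. of_int (c m) * (P m * y ^ e m n))"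
      unfolding W_def using Suc.prems by (intro sum.group[symmetric]) auto
    also have "\<dots> = (\<Sum>j<p. E j * y ^ j)"
      unfolding E_def sum_distrib_right by (intro sum.cong) (auto simp: mult.assoc)
    finally show ?thesis .
  qed
  obtain I where I: "I \<in> B" "\<And>x. x \<in> I \<Longrightarrow> \<exists>h\<in>G.
      h ?g = ?g + x \<and> (\<forall>j<n. h (gs ! j) = gs ! j)"
    using translate[of n] Suc.prems(1) by auto
  obtain x where x: "x \<in> I" "\<not> of_nat p dvd E d * embed x ^ d"
    using not_dvd[OF \<open>\<not> of_nat p dvd E d\<close> \<open>d < p\<close> I(1)] by blast
  show ?case
  proof
    assume "of_nat p dvd (\<Sum>m\<in>M. of_int (c m) * (\<Prod>i<Suc n. embed (gs ! i) ^ e m i))"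
    then have root: "of_nat p dvd W (embed ?g)"
      by (simp add: W_def P_def)
    have "of_nat p dvd (\<Sum>j\<le>d. E j * (embed ?g + of_nat k * embed x) ^ j)" for k
    proof -
      \<comment> \<open>Every multiple of \<open>x\<close> stays in \<open>I\<close>, so one choice
        of \<open>x\<close> provides automorphisms for the whole line
        \<open>?g + k x\<close>.\<close>
      have "zmul (int k) x \<in> I"
        using two_sided_ideal_zmul[OF ideal[OF I(1)] x(1)] .
      then obtain h where h: "h \<in> G" "h ?g = ?g + zmul (int k) x" "\<forall>j<n. h (gs ! j) = gs ! j"
        using I(2) by blast
      define H where "H = map_unitization h"
      note H = map_unitization_hom[of h, folded H_def]
      have H_add: "H (u + v) = H u + H v" and H_mult: "H (u * v) = H u * H v"
        and H_int: "H (of_int z) = of_int z" for u v z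
        using G[OF h(1)] H by blast+
      have H_0: "H 0 = 0" and H_1: "H 1 = 1"
        using H_int[of 0] H_int[of 1] by simp_all
      have H_sum: "H (sum a A) = (\<Sum>t\<in>A. H (a t))" for a and A :: "'m set"
        by (induction A rule: infinite_finite_induct) (simp_all add: H_0 H_add)
      have H_prod: "H (prod a A) = (\<Prod>t\<in>A. H (a t))" for a and A :: "nat set"
        by (induction A rule: infinite_finite_induct) (simp_all add: H_1 H_mult)
      have H_power: "H (u ^ t) = H u ^ t" for u t
        by (induction t) (simp_all add: H_1 H_mult)
      \<comment> \<open>\<open>H\<close> fixes the coefficients of \<open>W\<close> and moves only
        the argument, so the translate is a root modulo \<open>p\<close> as well.\<close>
      have "H (P m) = P m" for m
        unfolding P_def H_prod H_power using h(3) by (intro prod.cong) (auto simp: H_def)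
      then have "H (W (embed ?g)) = W (H (embed ?g))"
        by (simp add: W_def H_sum H_mult H_int H_power)
      moreover have "H (embed ?g) = embed ?g + of_nat k * embed x"
        by (simp add: H_def h(2) of_nat_unitization unitization.expand)
      moreover have "of_nat p dvd H (W (embed ?g))"
        using root H_int[of "int p"] by (auto elim!: dvdE simp: H_mult)
      ultimately have "of_nat p dvd (\<Sum>j<p. E j * (embed ?g + of_nat k * embed x) ^ j)"
        by (simp add: W)
      \<comment> \<open>Discard the terms above \<open>d\<close>, which vanish modulo
        \<open>p\<close>.\<close>
      also have "{..<p} = {..d} \<union> {d<..<p}"
        using \<open>d < p\<close> by auto
      also have "(\<Sum>j\<in>{..d} \<union> {d<..<p}. E j * (embed ?g + of_nat k * embed x) ^ j)
          = (\<Sum>j\<le>d. E j * (embed ?g + of_nat k * embed x) ^ j)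
            + (\<Sum>j\<in>{d<..<p}. E j * (embed ?g + of_nat k * embed x) ^ j)"
        by (rule sum.union_disjoint) auto
      finally show ?thesis
        using above by (subst (asm) dvd_add_left_iff) (auto intro!: dvd_sum)
    qed
    then show False
      using dvd_leading_term_if_dvd_line[OF p \<open>d < p\<close>] x(2) by blast
  qed
qed

section \<open>Reduction of the scalars\<close>

text \<open>When \<open>p\<close> kills the ring, this is the quotient map onto the unitization over
  the prime field, with the multiples of \<open>p\<close> as kernel.\<close>

definition reduce_scalars :: "'a unitization \<Rightarrow> 'p::prime_card mod_ring \<times> 'a::comm_ring" where
  "reduce_scalars u = (of_int (scalar_part u), ring_part u)"

lemma of_int_mod_ring_eq_0_iff:
  "(of_int k :: 'p::prime_card mod_ring) = 0 \<longleftrightarrow> int CARD('p) dvd k"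
  by (simp add: of_int_eq_0_iff_char_dvd)

text \<open>The representative used by \<open>scal\<close> differs from \<open>k\<close> by a
  multiple of \<open>p\<close>, which acts as \<open>0\<close>.\<close>

lemma scal_of_int:
  assumes char: "\<And>r::'a::ring. nmul CARD('p) r = 0"
  shows "scal (of_int k :: 'p::prime_card mod_ring) (r :: 'a) = zmul k r"
proof -
  define l where "l = to_int_mod_ring (of_int k :: 'p mod_ring)"
  have "(of_int (l - k) :: 'p mod_ring) = 0"
    unfolding l_def of_int_diff by (simp add: of_int_of_int_mod_ring)
  then obtain t where "l - k = t * int CARD('p)"
    unfolding of_int_mod_ring_eq_0_iff by (metis dvdE mult.commute)
  then have "l = k + t * int CARD('p)"
    by simp
  then have "zmul l r = zmul k r"
    by (simp add: zmul_add zmul_mult zmul_int char)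
  moreover have "0 \<le> l"
    unfolding l_def by transfer auto
  ultimately show ?thesis
    by (simp add: scal_def l_def[symmetric] zmul_int[symmetric])
qed

lemma reduce_scalars_mult:
  assumes "\<And>r::'a::comm_ring. nmul CARD('p) r = 0"
  shows "reduce_scalars (u * v) = unit_mult (reduce_scalars u) (reduce_scalars v :: 'p::prime_card mod_ring \<times> 'a)"
  by (simp add: reduce_scalars_def unit_mult_def scal_of_int[OF assms])

lemma reduce_scalars_1: "reduce_scalars 1 = unit_one"
  by (simp add: reduce_scalars_def unit_one_def)

lemma reduce_scalars_power:
  assumes "\<And>r::'a::comm_ring. nmul CARD('p) r = 0"
  shows "reduce_scalars (u ^ k) = unit_power (reduce_scalars u :: 'p::prime_card mod_ring \<times> 'a) k"
  by (induction k) (simp_all add: unit_power_def reduce_scalars_1 reduce_scalars_mult[OF assms])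

lemma reduce_scalars_prod_list:
  assumes "\<And>r::'a::comm_ring. nmul CARD('p) r = 0"
  shows "reduce_scalars (prod_list us)
    = foldr unit_mult (map reduce_scalars us) (unit_one :: 'p::prime_card mod_ring \<times> 'a)"
  by (induction us) (simp_all add: reduce_scalars_1 reduce_scalars_mult[OF assms])

lemma reduce_scalars_add: "reduce_scalars (u + v) = reduce_scalars u + reduce_scalars v"
  by (simp add: reduce_scalars_def)

lemma reduce_scalars_0: "reduce_scalars 0 = 0"
  by (simp add: reduce_scalars_def zero_prod_def)

lemma reduce_scalars_sum: "reduce_scalars (sum a A) = (\<Sum>m\<in>A. reduce_scalars (a m))"
  by (induction A rule: infinite_finite_induct) (simp_all add: reduce_scalars_0 reduce_scalars_add)

lemma monomial_value_eq_reduce_scalars: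
  fixes gs :: "'a::comm_ring list"
  assumes "\<And>r::'a. nmul CARD('p) r = 0"
  shows "(monomial_value gs m :: 'p::prime_card mod_ring \<times> 'a)
    = reduce_scalars (\<Prod>i<length gs. embed (gs ! i) ^ Poly_Mapping.lookup m i)"
proof -
  have "(\<Prod>i<length gs. embed (gs ! i) ^ Poly_Mapping.lookup m i)
      = prod_list (map (\<lambda>i. embed (gs ! i) ^ Poly_Mapping.lookup m i) [0..<length gs])"
    by (simp add: prod.distinct_set_conv_list[symmetric] atLeast0LessThan)
  moreover have "unit_power (0, gs ! i) k
      = (reduce_scalars (embed (gs ! i) ^ k) :: 'p mod_ring \<times> 'a)" for i k
    by (simp add: reduce_scalars_power[OF assms]) (simp add: reduce_scalars_def)
  ultimately show ?thesis
    by (simp add: monomial_value_def reduce_scalars_prod_list[OF assms] o_def)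
qed

text \<open>Lift each coefficient to its integer representative, evaluate in the integral
  unitization, and reduce.\<close>

lemma poly_value_eq_reduce_scalars:
  fixes gs :: "'a::comm_ring list" and f :: "'p::prime_card mod_ring mpoly"
  assumes "\<And>r::'a. nmul CARD('p) r = 0"
  shows "poly_value gs f = reduce_scalars (\<Sum>m\<in>Poly_Mapping.keys f.
    of_int (to_int_mod_ring (Poly_Mapping.lookup f m)) *
      (\<Prod>i<length gs. embed (gs ! i) ^ Poly_Mapping.lookup m i))"
proof -
  have "(c, 0) = (reduce_scalars (of_int (to_int_mod_ring c)) :: 'p mod_ring \<times> 'a)" for c
    by (simp add: reduce_scalars_def of_int_unitization of_int_of_int_mod_ring)
  then show ?thesis
    by (simp add: poly_value_def reduce_scalars_sum reduce_scalars_mult[OF assms]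
        monomial_value_eq_reduce_scalars[OF assms])
qed

lemma dvd_if_reduce_scalars_eq_0:
  fixes u :: "'a::comm_ring unitization"
  assumes "\<And>r::'a. nmul CARD('p) r = 0"
    and "reduce_scalars u = (0 :: 'p::prime_card mod_ring \<times> 'a)"
  shows "of_nat CARD('p) dvd u"
  using assms(2) dvd_unitization_iff[OF assms(1)]
  by (simp add: reduce_scalars_def zero_prod_def of_int_mod_ring_eq_0_iff)

theorem proposition4p2:
  fixes B :: "'a::{comm_ring, topological_ab_group_add, topological_semigroup_mult, t2_space} set set"
    and G :: "('a \<Rightarrow> 'a) set"
    and p n :: nat
    and f :: "'p::prime_card mod_ring mpoly"
    and gs :: "'a list"
  assumes p: "p = CARD('p)"
    and R: "small_profinite_ring B G"
    and non_nilpotent: "\<not> nilpotent_ring TYPE('a)"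
    and char_p: "has_char TYPE('a) p"
    and nilexponent_p: "nil_of_nilexponent TYPE('a) p"
    and quotients: "\<And>a::'a. a \<noteq> 0 \<Longrightarrow> \<not> nilpotent_quotient (Ann a)"
    and f_variables: "in_variables n f"
    and f_nonzero: "f \<noteq> 0"
    and f_degrees: "\<And>i. i < n \<Longrightarrow> degree_in i f < p"
    and gs_length: "length gs = n"
    and gs_generic: "independent_generics G gs"
  shows "poly_value gs f \<noteq> 0"
proof
  interpret small_profinite_ring B G by (rule R)
  have prime: "prime p"
    unfolding p by (rule prime_card)
  have char: "nmul p r = 0" for r :: 'a
    using char_p by (simp add: has_char_def)
  have nil: "u ^ p = 0" if "scalar_part u = 0" for u :: "'a unitization"
  proof -
    have "u = embed (ring_part u)"
      using that by (simp add: unitization.expand)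
    moreover have "1 \<le> p" "pos_power (ring_part u) p = 0"
      using nilexponent_p by (simp_all add: nil_of_nilexponent_def)
    ultimately show ?thesis
      by (metis embed_pos_power zero_unitization_def)
  qed
  \<comment> \<open>An integral lift of the value of \<open>f\<close>; the claim becomes that
    \<open>p\<close> does not divide it.\<close>
  define F where "F = (\<Sum>m\<in>Poly_Mapping.keys f.
      of_int (to_int_mod_ring (Poly_Mapping.lookup f m)) *
      (\<Prod>i<n. embed (gs ! i) ^ Poly_Mapping.lookup m i))"
  have "\<not> of_nat p dvd F"
    unfolding F_def
  proof (rule monomial_sum_not_dvd[where G = G and B = B])
    show "(\<forall>x y. h (x + y) = h x + h y) \<and> (\<forall>x y. h (x * y) = h x * h y)" if "h \<in> G" for h
      using group_sub that by (auto simp: Aut_basis_def)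
    show "\<exists>I\<in>B. \<forall>x\<in>I. \<exists>h\<in>G. h (gs ! i) = gs ! i + x \<and> (\<forall>j<i. h (gs ! j) = gs ! j)"
      if "i < length gs" for i
      using independent_generics_translate[OF R gs_generic that] by metis
    show "\<exists>x\<in>I. \<not> of_nat p dvd u * embed x ^ d"
      if "\<not> of_nat p dvd u" "d < p" "I \<in> B" for u d I
      using exists_not_dvd_mult_power[OF prime that(2) compact_ring _ _ char nil non_nilpotent
          quotients that(1), of I] basis_ideal[OF that(3)] by blast
    show "m = m'" if "m \<in> Poly_Mapping.keys f" "m' \<in> Poly_Mapping.keys f"
      "\<And>i. i < n \<Longrightarrow> Poly_Mapping.lookup m i = Poly_Mapping.lookup m' i" for m m'
    proof (rule poly_mapping_eqI)
      fix i
      \<comment> \<open>Exponents at indices from \<open>n\<close> on are \<open>0\<close>, so the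
        first \<open>n\<close> exponents determine the monomial.\<close>
      have "Poly_Mapping.keys m \<subseteq> {..<n}" "Poly_Mapping.keys m' \<subseteq> {..<n}"
        using f_variables that(1,2) by (auto simp: in_variables_def)
      then show "Poly_Mapping.lookup m i = Poly_Mapping.lookup m' i"
        using that(3) by (metis in_keys_iff lessThan_iff subsetD)
    qed
    show "Poly_Mapping.lookup m i < p" if "m \<in> Poly_Mapping.keys f" "i < n" for m i
    proof -
      have "Poly_Mapping.lookup m i \<le> degree_in i f"
        unfolding degree_in_def using that by (intro Max_ge) auto
      then show ?thesis
        using f_degrees[OF that(2)] by simp
    qed
    obtain m where m: "m \<in> Poly_Mapping.keys f"
      using f_nonzero by (metis all_not_in_conv keys_eq_empty)
    have "of_int (to_int_mod_ring c) = c" for c :: "'p mod_ring"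
      by (simp add: of_int_of_int_mod_ring)
    then have "\<not> int p dvd to_int_mod_ring (Poly_Mapping.lookup f m)"
      using m unfolding p of_int_mod_ring_eq_0_iff[symmetric, where 'p = 'p]
      by (simp add: in_keys_iff)
    then show "\<exists>m\<in>Poly_Mapping.keys f. \<not> int p dvd to_int_mod_ring (Poly_Mapping.lookup f m)"
      using m by blast
  qed (use char prime gs_length basis_ideal in auto)
  moreover assume "poly_value gs f = 0"
  then have "reduce_scalars F = (0 :: 'p mod_ring \<times> 'a)"
    using poly_value_eq_reduce_scalars[of gs f] char gs_length by (simp add: p F_def)
  then have "of_nat p dvd F"
    using dvd_if_reduce_scalars_eq_0[where 'p = 'p, of F] char by (simp add: p)
  ultimately show False ..
qed

end
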